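(* Assume $1<|\mathcal X|<|\mathcal Y|$ and $\mathcal W_\kappa(\mathcal Y,\mathcal E)\neq\emptyset$. Then $$\overline{\mathcal H}_\kappa(\mathcal Y,\mathcal E)\cong\left(\operatorname{span}(\mathcal G_\kappa(\mathcal Y,\mathcal E))+\mathcal N(\mathcal Y,\mathcal E)\right)/\mathcal N(\mathcal Y,\mathcal E),$$ in the sense that the quotient map $\mathcal F(\mathcal Y,\mathcal E)\to\mathcal F(\mathcal Y,\mathcal E)/\mathcal N(\mathcal Y,\mathcal E)$ restricts to a bijection from $\overline{\mathcal H}_\kappa(\mathcal Y,\mathcal E)$ onto the linear subspace on the right-hand side.
   Context: Let $\mathcal Y$ be a finite set and $\mathcal E\subset\mathcal Y^2$ a nonempty edge set such that the digraph $(\mathcal Y,\mathcal E)$ is strongly connected. $\mathcal F(\mathcal Y,\mathcal E)=\mathbb R^{\mathcal E}$ is the space of real functions on $\mathcal E$, identified with real $\mathcal Y\times\mathcal Y$ matrices vanishing outside $\mathcal E$; $\mathcal F^+(\mathcal Y,\mathcal E)$ is the subset of those that are strictly positive on $\mathcal E$; $\mathcal W(\mathcal Y,\mathcal E)\subset\mathcal F^+(\mathcal Y,\mathcal E)$ is the set of row-stochastic ones. Let $\kappa\colon\mathcal Y\to\mathcal X$ be surjective, $\mathcal S_x=\kappa^{-1}(x)$, $\mathcal D=\{(\kappa(y),\kappa(y')):(y,y')\in\mathcal E\}$, and write $F(y,\mathcal S_{x'})=\sum_{y'\in\mathcal S_{x'}}F(y,y')$. $F\in\mathcal F(\mathcal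 Y,\mathcal E)$ is $\kappa$-lumpable if $F(y_1,\mathcal S_{x'})=F(y_2,\mathcal S_{x'})$ for all $(x,x')\in\mathcal D$ and $y_1,y_2\in\mathcal S_x$. $\mathcal F^+_\kappa(\mathcal Y,\mathcal E)$ and $\mathcal W_\kappa(\mathcal Y,\mathcal E)$ are the sets of $\kappa$-lumpable elements of $\mathcal F^+(\mathcal Y,\mathcal E)$ and $\mathcal W(\mathcal Y,\mathcal E)$. $\mathcal G_\kappa(\mathcal Y,\mathcal E)=\{\log F:F\in\mathcal F_\kappa^+(\mathcal Y,\mathcal E)\}\subset\mathcal F(\mathcal Y,\mathcal E)$, with $\log$ entrywise on $\mathcal E$; $\operatorname{span}$ is the linear span. $\mathcal N(\mathcal Y,\mathcal E)$ is the linear space of $N\in\mathcal F(\mathcal Y,\mathcal E)$ of the form $N(y,y')=f(y')-f(y)+c$ with $f\in\mathbb R^{\mathcal Y}$, $c\in\mathbb R$. For $F\in\mathcal F^+(\mathcal Y,\mathcal E)$ with Perron–Frobenius root $\rho_F$ and positive right eigenvector $v_F$, $\mathfrak s(F)(y,y')=\frac{F(y,y')v_F(y')}{\rho_F v_F(y)}$, so $\mathfrak s(F)\in\mathcal W(\mathcal Y,\mathcal E)$. For $\mathcal V\subset\mathcal W(\mathcal Y,\mathcal E)$, $\operatorname{e-hull}(\mathcal V)$ is the set of all $\mathfrak s(\widetilde P)$ with $\log\widetilde P=\sum_{i=1}^k\alpha_i\log P_i$ (entrywise on $\mathcal E$), $k\in\mathbb N$, $\alpha\in\mathbb R^k$,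 $\sum_{i=1}^k\alpha_i=1$, $P_1,\dots,P_k\in\mathcal V$. Finally $\overline{\mathcal H}_\kappa(\mathcal Y,\mathcal E)=\{\log P:P\in\operatorname{e-hull}(\mathcal W_\kappa(\mathcal Y,\mathcal E))\}$. *)

theory Defs
  imports "HOL-Analysis.Analysis" "HOL-Library.Set_Algebras"
begin

text \<open>
  The finite vertex set is the universe of a type of class \<open>finite\<close>. A real function on the edge
  set \<open>E\<close> is a square matrix, indexed by vertices, which vanishes outside \<open>E\<close>.
\<close>

definition strongly_connected :: "('y \<times> 'y) set \<Rightarrow> bool" where
  "strongly_connected E \<longleftrightarrow> (\<forall>y y'. (y, y') \<in> E\<^sup>*)"

definition edge_space :: "('y::finite \<times> 'y) set \<Rightarrow> (real^'y^'y) set" where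
  "edge_space E = {F. \<forall>y y'. (y, y') \<notin> E \<longrightarrow> F $ y $ y' = 0}"

definition pos_edge_space :: "('y::finite \<times> 'y) set \<Rightarrow> (real^'y^'y) set" where
  "pos_edge_space E = {F \<in> edge_space E. \<forall>(y, y') \<in> E. F $ y $ y' > 0}"

definition stochastic :: "('y::finite \<times> 'y) set \<Rightarrow> (real^'y^'y) set" where
  "stochastic E = {F \<in> pos_edge_space E. \<forall>y. (\<Sum>y'\<in>UNIV. F $ y $ y') = 1}"

definition lumped_edges :: "('y \<Rightarrow> 'x) \<Rightarrow> ('y \<times> 'y) set \<Rightarrow> ('x \<times> 'x) set" where
  "lumped_edges \<kappa> E = {(\<kappa> y, \<kappa> y') | y y'. (y, y') \<in> E}"

definition fibre_sum :: "('y::finite \<Rightarrow> 'x) \<Rightarrow> real^'y^'y \<Rightarrow> 'y \<Rightarrow> 'x \<Rightarrow> real" where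
  "fibre_sum \<kappa> F y x' = (\<Sum>y' \<in> \<kappa> -` {x'}. F $ y $ y')"

definition lumpable :: "('y::finite \<Rightarrow> 'x) \<Rightarrow> ('y \<times> 'y) set \<Rightarrow> real^'y^'y \<Rightarrow> bool" where
  "lumpable \<kappa> E F \<longleftrightarrow>
     (\<forall>(x, x') \<in> lumped_edges \<kappa> E. \<forall>y1 \<in> \<kappa> -` {x}. \<forall>y2 \<in> \<kappa> -` {x}.
        fibre_sum \<kappa> F y1 x' = fibre_sum \<kappa> F y2 x')"

definition lumpable_pos :: "('y::finite \<Rightarrow> 'x) \<Rightarrow> ('y \<times> 'y) set \<Rightarrow> (real^'y^'y) set" where
  "lumpable_pos \<kappa> E = {F \<in> pos_edge_space E. lumpable \<kappa> E F}"

definition lumpable_stochastic :: "('y::finite \<Rightarrow> 'x) \<Rightarrow> ('y \<times> 'y) set \<Rightarrow> (real^'y^'y) set" where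
  "lumpable_stochastic \<kappa> E = {P \<in> stochastic E. lumpable \<kappa> E P}"

definition edge_log :: "('y::finite \<times> 'y) set \<Rightarrow> real^'y^'y \<Rightarrow> real^'y^'y" where
  "edge_log E F = (\<chi> y y'. if (y, y') \<in> E then ln (F $ y $ y') else 0)"

definition log_lumpable :: "('y::finite \<Rightarrow> 'x) \<Rightarrow> ('y \<times> 'y) set \<Rightarrow> (real^'y^'y) set" where
  "log_lumpable \<kappa> E = edge_log E ` lumpable_pos \<kappa> E"

definition null_space :: "('y::finite \<times> 'y) set \<Rightarrow> (real^'y^'y) set" where
  "null_space E = {N \<in> edge_space E.
     \<exists>(f :: 'y \<Rightarrow> real) c. \<forall>(y, y') \<in> E. N $ y $ y' = f y' - f y + c}"

text \<open>The Perron--Frobenius root of a nonnegative matrix is its spectral radius.\<close>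

definition pf_root :: "real^'y^'y \<Rightarrow> real" where
  "pf_root F = Sup {cmod l | l. \<exists>u :: complex^'y. u \<noteq> 0 \<and>
     (\<chi> y y'. complex_of_real (F $ y $ y')) *v u = l *s u}"

text \<open>
  For irreducible \<open>F\<close> the positive right eigenvector is unique up to a positive factor, which
  cancels in the quotient defining \<open>stoch_rescale\<close> below.
\<close>

definition pf_vector :: "real^'y^'y \<Rightarrow> real^'y" where
  "pf_vector F = (SOME v. (\<forall>y. v $ y > 0) \<and> F *v v = pf_root F *s v)"

definition stoch_rescale :: "real^'y^'y \<Rightarrow> real^'y^'y" where
  "stoch_rescale F =
     (\<chi> y y'. F $ y $ y' * pf_vector F $ y' / (pf_root F * pf_vector F $ y))"

definition e_hull :: "('y::finite \<times> 'y) set \<Rightarrow> (real^'y^'y) set \<Rightarrow> (real^'y^'y) set" where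
  "e_hull E V = {stoch_rescale Q | Q. Q \<in> pos_edge_space E \<and>
     (\<exists>(k::nat) (\<alpha> :: nat \<Rightarrow> real) P. (\<Sum>i=1..k. \<alpha> i) = 1 \<and> (\<forall>i\<in>{1..k}. P i \<in> V) \<and>
        edge_log E Q = (\<Sum>i=1..k. \<alpha> i *\<^sub>R edge_log E (P i)))}"

definition log_e_hull :: "('y::finite \<Rightarrow> 'x) \<Rightarrow> ('y \<times> 'y) set \<Rightarrow> (real^'y^'y) set" where
  "log_e_hull \<kappa> E = edge_log E ` e_hull E (lumpable_stochastic \<kappa> E)"

text \<open>
  Elements of a quotient vector space are cosets \<open>A +o N\<close>; for \<open>N \<subseteq> U\<close>, the subspace \<open>U / N\<close> is
  the set of the cosets of elements of \<open>U\<close>.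
\<close>

definition coset_map :: "'v::real_vector set \<Rightarrow> 'v \<Rightarrow> 'v set" where
  "coset_map N A = A +o N"

definition quotient_space :: "'v::real_vector set \<Rightarrow> 'v set \<Rightarrow> 'v set set" where
  "quotient_space U N = coset_map N ` U"

lemma subspace_edge_space: "subspace (edge_space E)"
  by (auto simp: subspace_def edge_space_def)

lemma null_spaceI:
  assumes "N \<in> edge_space E" "\<And>y y'. (y, y') \<in> E \<Longrightarrow> N $ y $ y' = f y' - f y + c"
  shows "N \<in> null_space E"
  unfolding null_space_def using assms by (auto intro!: exI[of _ f] exI[of _ c])

lemma null_spaceE:
  assumes "N \<in> null_space E"
  obtains f c where "N \<in> edge_space E" "\<And>y y'. (y, y') \<in> E \<Longrightarrow> N $ y $ y' = f y' - f y + c"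
  using assms unfolding null_space_def by fast

lemma subspace_null_space: "subspace (null_space E)"
proof (unfold subspace_def, intro conjI ballI allI)
  show "0 \<in> null_space E"
    by (rule null_spaceI[where f = "\<lambda>_. 0" and c = 0]) (auto simp: edge_space_def)
next
  fix M N assume "M \<in> null_space E" "N \<in> null_space E"
  then obtain f c g d where MN: "M \<in> edge_space E" "N \<in> edge_space E"
    and M: "\<And>y y'. (y, y') \<in> E \<Longrightarrow> M $ y $ y' = f y' - f y + c"
    and N: "\<And>y y'. (y, y') \<in> E \<Longrightarrow> N $ y $ y' = g y' - g y + d"
    by (metis null_spaceE)
  show "M + N \<in> null_space E"
    by (rule null_spaceI[where f = "\<lambda>z. f z + g z" and c = "c + d"])
      (use MN subspace_edge_space subspace_add in blast, simp add: M N)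
next
  fix r :: real and N assume "N \<in> null_space E"
  then obtain f c where NE: "N \<in> edge_space E"
    and N: "\<And>y y'. (y, y') \<in> E \<Longrightarrow> N $ y $ y' = f y' - f y + c"
    by (metis null_spaceE)
  show "r *\<^sub>R N \<in> null_space E"
    by (rule null_spaceI[where f = "\<lambda>z. r * f z" and c = "r * c"])
      (use NE subspace_edge_space subspace_scale in blast, simp add: N algebra_simps)
qed

lemma subspace_span_plus_null_space: "subspace (span (log_lumpable \<kappa> E) + null_space E)"
proof -
  have "span (log_lumpable \<kappa> E) + null_space E =
      {x + y | x y. x \<in> span (log_lumpable \<kappa> E) \<and> y \<in> null_space E}"
    unfolding set_plus_def by blast
  then show ?thesis
    by (simp only:) (rule subspace_sums[OF subspace_span subspace_null_space])
qed

end

theory Submission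
  imports Defs
begin

text \<open>
  \<^bold>\<open>Injectivity.\<close> Every element of the e-hull is stochastic. If the logarithms of two stochastic
  matrices \<open>P\<close>, \<open>Q\<close> differ by \<open>f y' - f y + c\<close>, then \<open>exp f\<close> is a positive eigenvector of \<open>P\<close>; by
  the maximum principle its eigenvalue is 1 and it is constant, so \<open>P = Q\<close>
  (\<open>stochastic_inj_mod_null_space\<close>).

  \<^bold>\<open>Range.\<close> Stochastic rescaling changes the logarithm of a matrix only by an element of the null
  space, so the e-hull gives, modulo the null space, the affine combinations of logarithms of
  lumpable stochastic matrices. The claim is that these already fill the linear span of the
  logarithms of all positive lumpable matrices. Two facts close the gap.

  First, a positive lumpable matrix \<open>F\<close> maps functions that are constant on fibres to such
  functions, so it has a positive eigenvector that is constant on fibres. Rescaling \<open>F\<close> by this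
  eigenvector gives a stochastic matrix that is again lumpable. Hence allowing \<open>F\<close> to be
  non-stochastic adds nothing modulo the null space (\<open>lumpable_pos_mod_null_space\<close>).

  Second, the affine hull of the logarithms of positive lumpable matrices contains 0, so it is equal
  to their span (\<open>zero_in_affine_hull_log_lumpable\<close>). Start from the matrix that is uniform, with
  sum 1, on the edges from each vertex to each fibre. Its logarithm is 0 at an edge that is alone in
  such a block. Inside a block with at least two edges one can move mass between two edges without
  disturbing lumpability; the logarithm is nonlinear, so these moves generate every coordinate
  direction, and the logarithm can be cancelled there.

  Perron--Frobenius theory enters through one application of Brouwer's theorem to the part of the
  simplex in an invariant subspace (\<open>perron_eigenvector_invariant_subspace\<close>). The subspace is the
  whole space for the spectral-radius eigenvector, and the functions constant on fibres for the
  lumpable one.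
\<close>

section \<open>Matrices supported on an edge set\<close>

lemma matrix_vector_nth: "(F *v v) $ y = (\<Sum>y'\<in>UNIV. F $ y $ y' * v $ y')"
  by (simp add: matrix_vector_mult_def)

lemma edge_pos: "F \<in> pos_edge_space E \<Longrightarrow> (y, y') \<in> E \<Longrightarrow> F $ y $ y' > 0"
  unfolding pos_edge_space_def by blast

lemma off_edge_zero: "F \<in> pos_edge_space E \<Longrightarrow> (y, y') \<notin> E \<Longrightarrow> F $ y $ y' = 0"
  unfolding pos_edge_space_def edge_space_def by blast

lemma entry_nonneg: "F \<in> pos_edge_space E \<Longrightarrow> F $ y $ y' \<ge> 0"
  by (cases "(y, y') \<in> E") (auto dest: edge_pos off_edge_zero intro: less_imp_le)

lemma pos_edge_spaceI:
  assumes "\<And>y y'. (y, y') \<in> E \<Longrightarrow> F $ y $ y' > 0" "\<And>y y'. (y, y') \<notin> E \<Longrightarrow> F $ y $ y' = 0"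
  shows "F \<in> pos_edge_space E"
  unfolding pos_edge_space_def edge_space_def using assms by auto

lemma edge_log_nth: "edge_log E F $ y $ y' = (if (y, y') \<in> E then ln (F $ y $ y') else 0)"
  by (simp add: edge_log_def)

lemma edge_log_in_edge_space: "edge_log E F \<in> edge_space E"
  by (simp add: edge_space_def edge_log_nth)

lemma strongly_connected_incoming:
  assumes "E \<noteq> {}" "strongly_connected E"
  obtains y where "(y, y') \<in> E"
proof -
  obtain a b where ab: "(a, b) \<in> E" using assms(1) by auto
  have "(b, y') \<in> E\<^sup>*" using assms(2) by (simp add: strongly_connected_def)
  then show thesis using that ab by (cases rule: rtranclE) auto
qed

text \<open>Positivity and similar properties of an eigenvector travel backwards along edges, because a
  value at \<open>y\<close> is computed from the values at the successors of \<open>y\<close>.\<close>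
lemma strongly_connected_propagate:
  assumes "strongly_connected E" "P z" "\<And>y y'. (y, y') \<in> E \<Longrightarrow> P y' \<Longrightarrow> P y"
  shows "P y"
proof -
  have "(y, z) \<in> E\<^sup>*" using assms(1) by (simp add: strongly_connected_def)
  then show ?thesis by (induction rule: converse_rtrancl_induct) (use assms in auto)
qed

section \<open>Perron eigenvectors\<close>

text \<open>
  The map \<open>v \<mapsto> F v / \<Sum>(F v)\<close> is a continuous self-map of the simplex intersected with \<open>K\<close>, and
  a fixed point of it is a nonnegative eigenvector; strong connectivity makes it positive. The
  subspace \<open>K\<close> allows further linear constraints to be imposed on the eigenvector. The
  positive vector \<open>p\<close> serves only to make the intersection nonempty.
\<close>
lemma perron_eigenvector_invariant_subspace:
  fixes F :: "real^'y^'y" and p :: "real^'y"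
  assumes F: "F \<in> pos_edge_space E" and E: "E \<noteq> {}" "strongly_connected E"
    and K: "subspace K" "\<And>v. v \<in> K \<Longrightarrow> F *v v \<in> K"
    and p: "p \<in> K" "\<And>y. p $ y > 0"
  obtains r v where "r > 0" "v \<in> K" "\<And>y. v $ y > 0" "F *v v = r *\<^sub>R v"
proof -
  define \<sigma> where "\<sigma> v = (\<Sum>y\<in>UNIV. v $ y)" for v :: "real^'y"
  define S where "S = {v \<in> K. (\<forall>y. 0 \<le> v $ y) \<and> \<sigma> v = 1}"
  define \<phi> where "\<phi> v = (1 / \<sigma> (F *v v)) *\<^sub>R (F *v v)" for v
  have \<sigma>_scale: "\<sigma> (c *\<^sub>R v) = c * \<sigma> v" for c v
    by (simp add: \<sigma>_def sum_distrib_left)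
  have Fnn: "(F *v v) $ y \<ge> 0" if "\<And>y. v $ y \<ge> 0" for v y
    unfolding matrix_vector_nth using that by (intro sum_nonneg mult_nonneg_nonneg entry_nonneg[OF F])
  have Fpos: "(F *v v) $ y > 0" if "\<And>y. v $ y \<ge> 0" "(y, y') \<in> E" "v $ y' > 0" for v y y'
    unfolding matrix_vector_nth
    by (rule sum_pos2[where i = y'])
      (use that edge_pos[OF F] entry_nonneg[OF F] in auto)
  have \<sigma>pos: "\<sigma> v > 0" if "\<And>y. v $ y \<ge> 0" "v $ y > 0" for v y
    unfolding \<sigma>_def by (rule sum_pos2[where i = y]) (use that in auto)
  have ex_pos: "\<exists>y. v $ y > 0" if "v \<in> S" for v
  proof (rule ccontr)
    assume "\<not> ?thesis"
    then have "\<sigma> v \<le> 0" unfolding \<sigma>_def by (intro sum_nonpos) (auto simp: not_less)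
    with that show False by (simp add: S_def)
  qed
  have F\<sigma>: "\<sigma> (F *v v) > 0" if "v \<in> S" for v
  proof -
    obtain y' where "v $ y' > 0" using ex_pos[OF \<open>v \<in> S\<close>] by blast
    \<comment> \<open>The normalising denominator does not vanish, since mass at \<open>y'\<close> is seen by some predecessor.\<close>
    moreover obtain y where "(y, y') \<in> E" using strongly_connected_incoming[OF E] .
    ultimately show ?thesis using \<open>v \<in> S\<close> Fpos[of v y y'] Fnn[of v] \<sigma>pos[of "F *v v" y]
      by (simp add: S_def)
  qed
  have cont\<sigma>: "continuous_on T \<sigma>" for T
    unfolding \<sigma>_def by (intro continuous_intros)
  have contF: "continuous_on T ((*v) F)" for T
    by (simp add: linear_continuous_on matrix_vector_mul_bounded_linear)
  have "closed S"
  proof -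
    have "S = K \<inter> (\<Inter>y. {v. 0 \<le> v $ y}) \<inter> {v. \<sigma> v = 1}" by (auto simp: S_def)
    moreover have "closed {v :: real^'y. 0 \<le> v $ y}" for y
      by (intro closed_Collect_le continuous_intros)
    moreover have "closed {v. \<sigma> v = 1}"
      by (intro closed_Collect_eq cont\<sigma> continuous_intros)
    ultimately show ?thesis using closed_subspace[OF K(1)]
      by (auto intro!: closed_Int closed_INT)
  qed
  moreover have "bounded S"
  proof (rule boundedI[where B = 1])
    fix v assume v: "v \<in> S"
    have "norm v \<le> (\<Sum>y\<in>UNIV. \<bar>v $ y\<bar>)" by (rule norm_le_l1_cart)
    also have "\<dots> = \<sigma> v" using v by (simp add: \<sigma>_def S_def)
    finally show "norm v \<le> 1" using v by (simp add: S_def)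
  qed
  ultimately have "compact S" by (simp add: compact_eq_bounded_closed)
  moreover have "convex S"
    using subspace_imp_convex[OF K(1)]
    by (auto simp: S_def convex_def \<sigma>_def sum.distrib simp flip: sum_distrib_left)
  moreover have "S \<noteq> {}"
  proof -
    have "\<sigma> p > 0" using p(2) \<sigma>pos[of p undefined] by (simp add: less_imp_le)
    then have "(1 / \<sigma> p) *\<^sub>R p \<in> S"
      using p K(1) by (auto simp: S_def \<sigma>_scale subspace_scale less_imp_le)
    then show ?thesis by blast
  qed
  moreover have "continuous_on S \<phi>"
  proof -
    have "continuous_on S (\<lambda>v. \<sigma> (F *v v))"
      using continuous_on_compose[OF contF cont\<sigma>] by (simp add: o_def)
    then show ?thesis unfolding \<phi>_def
      by (intro continuous_intros contF) (use F\<sigma> in force)+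
  qed
  moreover have "\<phi> \<in> S \<rightarrow> S"
  proof
    fix v assume v: "v \<in> S"
    have "\<phi> v \<in> K" using v K by (simp add: \<phi>_def S_def subspace_scale)
    moreover have "\<sigma> (\<phi> v) = 1" using F\<sigma>[OF v] by (simp add: \<phi>_def \<sigma>_scale)
    moreover have "\<phi> v $ y \<ge> 0" for y
      using F\<sigma>[OF v] Fnn[of v y] v by (simp add: \<phi>_def S_def)
    ultimately show "\<phi> v \<in> S" by (simp add: S_def)
  qed
  ultimately obtain v where v: "v \<in> S" "\<phi> v = v" using brouwer by metis
  define r where "r = \<sigma> (F *v v)"
  have r: "r > 0" using F\<sigma> v by (simp add: r_def)
  have eig: "F *v v = r *\<^sub>R v"
  proof -
    have "r *\<^sub>R v = r *\<^sub>R \<phi> v" using v(2) by simp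
    also have "\<dots> = F *v v" using r by (simp add: \<phi>_def flip: r_def)
    finally show ?thesis by simp
  qed
  obtain z where z: "v $ z > 0" using ex_pos v(1) by blast
  have "v $ y > 0" for y
  proof (rule strongly_connected_propagate[OF E(2), where P = "\<lambda>y. v $ y > 0", OF z])
    fix y y' assume "(y, y') \<in> E" "v $ y' > 0"
    then have "(F *v v) $ y > 0" using v(1) Fpos by (simp add: S_def)
    then show "v $ y > 0" using r by (simp add: eig zero_less_mult_iff)
  qed
  then show thesis using that[of r v] r eig v(1) unfolding S_def by blast
qed

text \<open>
  A positive eigenvector \<open>v\<close> with eigenvalue \<open>r\<close> bounds every complex eigenvalue: in the weighted
  maximum norm \<open>max |u y| / v y\<close> the matrix has operator norm \<open>r\<close>. So \<open>r\<close> is the spectral radius.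
\<close>
lemma pf_root_eq:
  fixes F :: "real^'y^'y"
  assumes nn: "\<And>y y'. F $ y $ y' \<ge> 0" and v: "\<And>y. v $ y > 0" and eig: "F *v v = r *\<^sub>R v" and r: "r > 0"
  shows "pf_root F = r"
proof -
  let ?C = "(\<chi> y y'. complex_of_real (F $ y $ y')) :: complex^'y^'y"
  have eig_nth: "(\<Sum>y'\<in>UNIV. F $ y $ y' * v $ y') = r * v $ y" for y
    using arg_cong[OF eig, of "\<lambda>w. w $ y"] by (simp add: matrix_vector_nth)
  show ?thesis unfolding pf_root_def
  proof (rule cSup_eq_maximum)
    let ?v = "(\<chi> y. complex_of_real (v $ y)) :: complex^'y"
    have "?C *v ?v = complex_of_real r *s ?v"
      by (simp add: vec_eq_iff matrix_vector_mult_def eig_nth flip: of_real_mult of_real_sum)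
    moreover have "?v \<noteq> 0" using v by (simp add: vec_eq_iff) (metis less_irrefl)
    ultimately show "r \<in> {cmod l |l. \<exists>u. u \<noteq> 0 \<and> ?C *v u = l *s u}"
      using r by (intro CollectI exI[of _ "complex_of_real r"]) auto
  next
    fix x assume "x \<in> {cmod l |l. \<exists>u. u \<noteq> 0 \<and> ?C *v u = l *s u}"
    then obtain l u where x: "x = cmod l" and u: "u \<noteq> 0" and lu: "?C *v u = l *s u" by blast
    define m where "m = Max (range (\<lambda>y. cmod (u $ y) / v $ y))"
    have le: "cmod (u $ y) \<le> m * v $ y" for y
    proof -
      have "cmod (u $ y) / v $ y \<le> m" unfolding m_def by (intro Max_ge) auto
      then show ?thesis using v[of y] by (simp add: field_simps)
    qed
    have "m \<in> range (\<lambda>y. cmod (u $ y) / v $ y)" unfolding m_def by (intro Max_in) auto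
    then obtain z where z: "m = cmod (u $ z) / v $ z" by blast
    obtain y0 where "u $ y0 \<noteq> 0" using u by (auto simp: vec_eq_iff)
    then have m: "m > 0" using le[of y0] v[of y0]
      by (metis less_le_trans zero_less_mult_pos2 zero_less_norm_iff)
    have "x * (m * v $ z) = cmod ((l *s u) $ z)"
      using v[of z] by (simp add: x z norm_mult)
    also have "\<dots> = cmod (\<Sum>y\<in>UNIV. complex_of_real (F $ z $ y) * u $ y)"
      by (simp add: matrix_vector_mult_def flip: lu)
    also have "\<dots> \<le> (\<Sum>y\<in>UNIV. F $ z $ y * (m * v $ y))"
      by (rule sum_norm_le) (use nn le in \<open>auto simp: norm_mult intro!: mult_left_mono\<close>)
    also have "\<dots> = r * (m * v $ z)"
      using eig_nth[of z] by (simp add: algebra_simps flip: sum_distrib_left)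
    finally show "x \<le> r" using m v[of z] by simp
  qed
qed

lemma pf_root_pf_vector:
  fixes F :: "real^'y^'y"
  assumes F: "F \<in> pos_edge_space E" and E: "E \<noteq> {}" "strongly_connected E"
  shows "pf_root F > 0" "pf_vector F $ y > 0" "F *v pf_vector F = pf_root F *\<^sub>R pf_vector F"
proof -
  obtain r v where rv: "r > 0" "\<And>y. v $ y > 0" "F *v v = r *\<^sub>R v"
    using perron_eigenvector_invariant_subspace[OF F E, of UNIV "\<chi> y. 1"] by auto
  then have root: "pf_root F = r" using pf_root_eq entry_nonneg[OF F] by blast
  have "(\<forall>y. pf_vector F $ y > 0) \<and> F *v pf_vector F = pf_root F *s pf_vector F"
    unfolding pf_vector_def
    by (rule someI[of _ v]) (use rv root in \<open>simp add: scalar_mult_eq_scaleR\<close>)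
  then show "pf_root F > 0" "pf_vector F $ y > 0" "F *v pf_vector F = pf_root F *\<^sub>R pf_vector F"
    using rv root by (simp_all add: scalar_mult_eq_scaleR)
qed

section \<open>Stochastic rescaling modulo the null space\<close>

text \<open>
  Rescaling by any positive eigenvector gives a stochastic matrix and changes the logarithm by a
  difference of potentials \<open>ln v\<close> and a constant. Keeping \<open>v\<close> arbitrary allows an eigenvector
  with extra symmetry to be used in place of \<^const>\<open>pf_vector\<close>.
\<close>
lemma doob_transform:
  fixes F :: "real^'y^'y"
  defines "P r v \<equiv> (\<chi> y y'. F $ y $ y' * v $ y' / (r * v $ y)) :: real^'y^'y"
  assumes F: "F \<in> pos_edge_space E" and r: "r > 0" and v: "\<And>y. v $ y > 0"
    and eig: "F *v v = r *\<^sub>R v"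
  shows "P r v \<in> stochastic E" "edge_log E (P r v) - edge_log E F \<in> null_space E"
proof -
  have "P r v \<in> pos_edge_space E"
    by (rule pos_edge_spaceI) (simp_all add: P_def v r edge_pos[OF F] off_edge_zero[OF F])
  moreover have "(\<Sum>y'\<in>UNIV. P r v $ y $ y') = 1" for y
  proof -
    have "(\<Sum>y'\<in>UNIV. P r v $ y $ y') = (F *v v) $ y / (r * v $ y)"
      by (simp add: P_def matrix_vector_nth sum_divide_distrib)
    then show ?thesis using r v[of y] by (simp add: eig)
  qed
  ultimately show "P r v \<in> stochastic E" by (simp add: stochastic_def)
  show "edge_log E (P r v) - edge_log E F \<in> null_space E"
  proof (rule null_spaceI[where f = "\<lambda>y. ln (v $ y)" and c = "- ln r"])
    show "edge_log E (P r v) - edge_log E F \<in> edge_space E"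
      by (intro subspace_diff subspace_edge_space edge_log_in_edge_space)
    fix y y' assume e: "(y, y') \<in> E"
    have "F $ y $ y' > 0" "v $ y > 0" "v $ y' > 0" using edge_pos[OF F e] v by auto
    then show "(edge_log E (P r v) - edge_log E F) $ y $ y' = ln (v $ y') - ln (v $ y) + - ln r"
      using e r by (simp add: edge_log_nth P_def ln_div ln_mult)
  qed
qed

lemma stoch_rescale_stochastic:
  assumes "F \<in> pos_edge_space E" "E \<noteq> {}" "strongly_connected E"
  shows "stoch_rescale F \<in> stochastic E"
    and "edge_log E (stoch_rescale F) - edge_log E F \<in> null_space E"
  unfolding stoch_rescale_def
  using doob_transform[OF assms(1) pf_root_pf_vector[OF assms]] by auto

text \<open>Minimum principle: where a harmonic function attains its minimum, the average over successors
  forces all successors to attain it too.\<close>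
lemma stochastic_harmonic_const:
  fixes P :: "real^'y^'y"
  assumes P: "P \<in> stochastic E" and g: "\<And>y. (\<Sum>y'\<in>UNIV. P $ y $ y' * g y') = g y"
    and sc: "strongly_connected E"
  shows "g y = g z"
proof -
  have Pp: "P \<in> pos_edge_space E" and row: "\<And>y. (\<Sum>y'\<in>UNIV. P $ y $ y') = 1"
    using P by (auto simp: stochastic_def)
  define m where "m = Min (range g)"
  have le: "m \<le> g y" for y unfolding m_def by (rule Min_le) auto
  have step: "g y' = m" if "g y = m" "(y, y') \<in> E" for y y'
  proof -
    have "(\<Sum>y'\<in>UNIV. P $ y $ y' * (g y' - m)) = g y - m"
      by (simp add: right_diff_distrib sum_subtractf g row flip: sum_distrib_right)
    then have "(\<Sum>y'\<in>UNIV. P $ y $ y' * (g y' - m)) = 0" using that by simp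
    then have "P $ y $ y' * (g y' - m) = 0"
      by (subst (asm) sum_nonneg_eq_0_iff) (use entry_nonneg[OF Pp] le in auto)
    then show ?thesis using edge_pos[OF Pp that(2)] by auto
  qed
  have "m \<in> range g" unfolding m_def by (rule Min_in) auto
  then obtain a where a: "g a = m" by auto
  have "g y = m" for y
  proof -
    have "(a, y) \<in> E\<^sup>*" using sc by (simp add: strongly_connected_def)
    then show ?thesis by (induction rule: rtrancl_induct) (use a step in auto)
  qed
  then show ?thesis by simp
qed

text \<open>
  Writing \<open>g = exp f\<close>, the row sums of \<open>Q\<close> say that \<open>P g = exp (- c) g\<close>. Comparing both sides where
  \<open>g\<close> is largest and where it is smallest gives \<open>c = 0\<close>, so \<open>g\<close> is harmonic, hence constant.
\<close>
lemma stochastic_inj_mod_null_space: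
  fixes P Q :: "real^'y^'y"
  assumes P: "P \<in> stochastic E" and Q: "Q \<in> stochastic E" and sc: "strongly_connected E"
    and diff: "edge_log E Q - edge_log E P \<in> null_space E"
  shows "P = Q"
proof -
  have Pp: "P \<in> pos_edge_space E" and Prow: "\<And>y. (\<Sum>y'\<in>UNIV. P $ y $ y') = 1"
    and Qp: "Q \<in> pos_edge_space E" and Qrow: "\<And>y. (\<Sum>y'\<in>UNIV. Q $ y $ y') = 1"
    using P Q by (auto simp: stochastic_def)
  obtain f c where fc: "\<And>y y'. (y, y') \<in> E \<Longrightarrow>
      (edge_log E Q - edge_log E P) $ y $ y' = f y' - f y + c"
    using diff by (rule null_spaceE) blast
  define g where "g y = exp (f y)" for y
  have QP: "Q $ y $ y' = P $ y $ y' * g y' / g y * exp c" for y y'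
  proof (cases "(y, y') \<in> E")
    case True
    have "ln (Q $ y $ y') = ln (P $ y $ y') + (f y' - f y + c)"
      using fc[OF True] True by (simp add: edge_log_nth)
    then have "exp (ln (Q $ y $ y')) = exp (ln (P $ y $ y')) * exp (f y' - f y + c)"
      by (simp add: exp_add)
    then show ?thesis using edge_pos[OF Pp True] edge_pos[OF Qp True]
      by (simp add: g_def exp_add exp_diff)
  qed (simp add: off_edge_zero[OF Pp] off_edge_zero[OF Qp])
  have gpos: "g y > 0" for y by (simp add: g_def)
  have harm: "(\<Sum>y'\<in>UNIV. P $ y $ y' * g y') * exp c = g y" for y
    using Qrow[of y] gpos[of y]
    by (simp add: QP field_simps flip: sum_distrib_left sum_distrib_right sum_divide_distrib)
  have "Max (range g) \<in> range g" "Min (range g) \<in> range g" by (auto intro!: Max_in Min_in)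
  then obtain a b where a: "g a = Max (range g)" and b: "g b = Min (range g)" by (metis imageE)
  have ga: "g y \<le> g a" and gb: "g b \<le> g y" for y unfolding a b by auto
  have "(\<Sum>y'\<in>UNIV. P $ a $ y' * g y') \<le> (\<Sum>y'\<in>UNIV. P $ a $ y' * g a)"
    by (intro sum_mono mult_left_mono ga entry_nonneg[OF Pp])
  then have "(\<Sum>y'\<in>UNIV. P $ a $ y' * g y') \<le> g a" by (simp add: Prow flip: sum_distrib_right)
  then have "g a \<le> g a * exp c" using harm[of a] by (metis exp_ge_zero mult_right_mono)
  then have c1: "exp c \<ge> 1" using gpos[of a] by simp
  have "(\<Sum>y'\<in>UNIV. P $ b $ y' * g b) \<le> (\<Sum>y'\<in>UNIV. P $ b $ y' * g y')"
    by (intro sum_mono mult_left_mono gb entry_nonneg[OF Pp])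
  then have "g b \<le> (\<Sum>y'\<in>UNIV. P $ b $ y' * g y')" by (simp add: Prow flip: sum_distrib_right)
  then have "g b * exp c \<le> g b" using harm[of b] by (metis exp_ge_zero mult_right_mono)
  then have "exp c \<le> 1" using gpos[of b] by simp
  with c1 have c: "exp c = 1" by simp
  then have "g y = g z" for y z using stochastic_harmonic_const[OF P _ sc, of g] harm by simp
  then have "Q $ y $ y' = P $ y $ y'" for y y' using QP[of y y'] c gpos[of y]
    by (metis less_irrefl mult.right_neutral nonzero_mult_div_cancel_right)
  then show ?thesis by (simp add: vec_eq_iff)
qed

section \<open>Lumpable matrices\<close>
lemma sum_fibrewise:
  fixes \<kappa> :: "'y::finite \<Rightarrow> 'x"
  shows "(\<Sum>y'\<in>UNIV. F $ y $ y' * w (\<kappa> y')) = (\<Sum>x'\<in>range \<kappa>. fibre_sum \<kappa> F y x' * w x')"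
proof -
  have "(\<Sum>y'\<in>UNIV. F $ y $ y' * w (\<kappa> y'))
      = (\<Sum>x'\<in>range \<kappa>. \<Sum>y'\<in>{y'\<in>UNIV. \<kappa> y' = x'}. F $ y $ y' * w (\<kappa> y'))"
    by (rule sum.image_gen) simp
  also have "\<dots> = (\<Sum>x'\<in>range \<kappa>. fibre_sum \<kappa> F y x' * w x')"
    by (auto simp: fibre_sum_def sum_distrib_right vimage_def intro!: sum.cong)
  finally show ?thesis .
qed

text \<open>Pairs of fibres that are not joined by an edge have fibre sum 0 from every vertex, so the
  restriction to lumped edges can be dropped.\<close>
lemma lumpable_iff:
  fixes F :: "real^'y^'y" and \<kappa> :: "'y \<Rightarrow> 'x"
  assumes F: "F \<in> pos_edge_space E"
  shows "lumpable \<kappa> E F \<longleftrightarrow>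
    (\<forall>y1 y2 x'. \<kappa> y1 = \<kappa> y2 \<longrightarrow> fibre_sum \<kappa> F y1 x' = fibre_sum \<kappa> F y2 x')" (is "_ \<longleftrightarrow> ?R")
proof
  assume L: "lumpable \<kappa> E F"
  have zero: "fibre_sum \<kappa> F y x' = 0" if "(\<kappa> y, x') \<notin> lumped_edges \<kappa> E" for y x'
    unfolding fibre_sum_def
    by (rule sum.neutral) (use that off_edge_zero[OF F] in \<open>auto simp: lumped_edges_def\<close>)
  show ?R
  proof (intro allI impI)
    fix y1 y2 x' assume eq: "\<kappa> y1 = \<kappa> y2"
    show "fibre_sum \<kappa> F y1 x' = fibre_sum \<kappa> F y2 x'"
    proof (cases "(\<kappa> y1, x') \<in> lumped_edges \<kappa> E")
      case True
      note bspec[OF L[unfolded lumpable_def] True, unfolded prod.case, rule_format]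
      then show ?thesis using eq by (metis vimage_singleton_eq)
    next
      case False
      then show ?thesis using zero[of y1] zero[of y2] eq by simp
    qed
  qed
next
  assume R: ?R
  show "lumpable \<kappa> E F"
    unfolding lumpable_def split_beta
  proof (intro ballI)
    fix e :: "'x \<times> 'x" and y1 y2 assume "y1 \<in> \<kappa> -` {fst e}" "y2 \<in> \<kappa> -` {fst e}"
    then have "\<kappa> y1 = \<kappa> y2" by simp
    then show "fibre_sum \<kappa> F y1 (snd e) = fibre_sum \<kappa> F y2 (snd e)" using R by blast
  qed
qed

text \<open>
  The functions that are constant on the fibres of \<open>\<kappa>\<close> form a subspace that is invariant under a
  lumpable matrix. An eigenvector in it rescales all entries from a vertex to a fibre by a
  factor that depends on the two fibres alone, and this preserves lumpability.
\<close>
lemma lumpable_pos_mod_null_space: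
  fixes F :: "real^'y^'y" and \<kappa> :: "'y \<Rightarrow> 'x"
  assumes F: "F \<in> lumpable_pos \<kappa> E" and E: "E \<noteq> {}" "strongly_connected E"
  obtains P where "P \<in> lumpable_stochastic \<kappa> E" "edge_log E P - edge_log E F \<in> null_space E"
proof -
  have Fp: "F \<in> pos_edge_space E" and L: "lumpable \<kappa> E F"
    using F by (auto simp: lumpable_pos_def)
  note Leq = L[unfolded lumpable_iff[OF Fp], rule_format]
  define K where "K = range (\<lambda>w :: 'x \<Rightarrow> real. (\<chi> y. w (\<kappa> y)) :: real^'y)"
  have K_iff: "v \<in> K \<longleftrightarrow> (\<exists>w. \<forall>y. v $ y = w (\<kappa> y))" for v
    by (auto simp: K_def vec_eq_iff)
  have "F *v v \<in> K" if v: "v \<in> K" for v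
  proof -
    obtain w where w: "\<And>y. v $ y = w (\<kappa> y)" using v K_iff by blast
    have "(F *v v) $ y1 = (F *v v) $ y2" if "\<kappa> y1 = \<kappa> y2" for y1 y2
      by (simp add: matrix_vector_nth w sum_fibrewise Leq[OF that])
    moreover have "\<kappa> y = \<kappa> (inv_into UNIV \<kappa> (\<kappa> y))" for y
      by (rule f_inv_into_f[symmetric]) simp
    ultimately have "(F *v v) $ y = (F *v v) $ inv_into UNIV \<kappa> (\<kappa> y)" for y by blast
    then show ?thesis
      unfolding K_iff by (intro exI[of _ "\<lambda>x. (F *v v) $ inv_into UNIV \<kappa> x"]) blast
  qed
  moreover have "subspace K"
    unfolding subspace_def
  proof (intro conjI ballI allI)
    show "0 \<in> K" unfolding K_iff by (intro exI[of _ "\<lambda>_. 0"]) simp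
    fix v c assume "v \<in> K"
    then obtain w where w: "\<And>y. v $ y = w (\<kappa> y)" unfolding K_iff by blast
    show "c *\<^sub>R v \<in> K" unfolding K_iff by (intro exI[of _ "\<lambda>x. c * w x"]) (simp add: w)
    fix v' assume "v' \<in> K"
    then obtain w' where w': "\<And>y. v' $ y = w' (\<kappa> y)" unfolding K_iff by blast
    show "v + v' \<in> K" unfolding K_iff by (intro exI[of _ "\<lambda>x. w x + w' x"]) (simp add: w w')
  qed
  moreover have "(\<chi> y. 1) \<in> K" unfolding K_iff by (intro exI[of _ "\<lambda>_. 1"]) simp
  ultimately obtain r v where rv: "r > 0" "v \<in> K" "\<And>y. v $ y > 0" "F *v v = r *\<^sub>R v"
    using perron_eigenvector_invariant_subspace[OF Fp E, of K "\<chi> y. 1"] by auto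
  define P :: "real^'y^'y" where "P = (\<chi> y y'. F $ y $ y' * v $ y' / (r * v $ y))"
  note doob = doob_transform[OF Fp rv(1,3,4), folded P_def]
  obtain w where w: "\<And>y. v $ y = w (\<kappa> y)" using rv(2) unfolding K_iff by blast
  have P_sum: "fibre_sum \<kappa> P y x' = fibre_sum \<kappa> F y x' * w x' / (r * w (\<kappa> y))" for y x'
    by (simp add: fibre_sum_def P_def w sum_divide_distrib sum_distrib_right)
  have "fibre_sum \<kappa> P y1 x' = fibre_sum \<kappa> P y2 x'" if "\<kappa> y1 = \<kappa> y2" for y1 y2 x'
    by (simp add: P_sum that Leq[OF that])
  then have "lumpable \<kappa> E P"
    using doob(1) lumpable_iff[of P E \<kappa>] unfolding stochastic_def by blast
  then show thesis using that[of P] doob by (simp add: lumpable_stochastic_def)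
qed

section \<open>The affine hull of the logarithms of lumpable matrices\<close>
definition edge_unit :: "'y::finite \<Rightarrow> 'y \<Rightarrow> real^'y^'y" where
  "edge_unit a b = (\<chi> y y'. if y = a \<and> y' = b then 1 else 0)"

text \<open>Two equal entries \<open>t, t\<close> in the same row and fibre are replaced by \<open>t/2, 3t/2\<close>: the fibre sum
  stays the same.\<close>
lemma log_lumpable_shift:
  fixes F :: "real^'y^'y"
  assumes F: "F \<in> lumpable_pos \<kappa> E" and e: "(a, b) \<in> E" "(a, c) \<in> E" "b \<noteq> c" "\<kappa> b = \<kappa> c"
    and eq: "F $ a $ b = F $ a $ c"
  shows "edge_log E F + (ln (1/2) *\<^sub>R edge_unit a b + ln (3/2) *\<^sub>R edge_unit a c) \<in> log_lumpable \<kappa> E"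
proof -
  have Fp: "F \<in> pos_edge_space E" and L: "lumpable \<kappa> E F"
    using F by (auto simp: lumpable_pos_def)
  define t where "t = F $ a $ b"
  have t: "t > 0" using edge_pos[OF Fp e(1)] by (simp add: t_def)
  define G where "G = F + (t/2) *\<^sub>R edge_unit a c - (t/2) *\<^sub>R edge_unit a b"
  have G: "G $ y $ y' = (if y = a \<and> y' = b then F $ y $ y' * (1/2)
      else if y = a \<and> y' = c then F $ y $ y' * (3/2) else F $ y $ y')" for y y'
    using e(3) eq by (auto simp: G_def edge_unit_def t_def)
  have Gp: "G \<in> pos_edge_space E"
    by (rule pos_edge_spaceI) (auto simp: G edge_pos[OF Fp] off_edge_zero[OF Fp])
  have unit: "fibre_sum \<kappa> (edge_unit a d) y x' = (if y = a \<and> \<kappa> d = x' then 1 else 0)" for d y x'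
    by (cases "y = a") (simp_all add: fibre_sum_def edge_unit_def)
  have "fibre_sum \<kappa> G y x' = fibre_sum \<kappa> F y x' + (t/2) * fibre_sum \<kappa> (edge_unit a c) y x'
      - (t/2) * fibre_sum \<kappa> (edge_unit a b) y x'" for y x'
    by (simp add: G_def fibre_sum_def sum.distrib sum_subtractf sum_distrib_left)
  then have "fibre_sum \<kappa> G y x' = fibre_sum \<kappa> F y x'" for y x' by (simp add: unit e(4))
  then have "lumpable \<kappa> E G" using L by (simp add: lumpable_def)
  then have "G \<in> lumpable_pos \<kappa> E" using Gp by (simp add: lumpable_pos_def)
  moreover have "edge_log E G
      = edge_log E F + (ln (1/2) *\<^sub>R edge_unit a b + ln (3/2) *\<^sub>R edge_unit a c)"
    using e edge_pos[OF Fp e(1)] edge_pos[OF Fp e(2)]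
    by (simp add: vec_eq_iff edge_log_nth G edge_unit_def ln_mult ln_div)
  ultimately show ?thesis unfolding log_lumpable_def by (metis imageI)
qed

text \<open>
  Take the uniform matrix \<open>F\<close> as origin and let \<open>T\<close> be the direction space of the affine hull. A
  mass move within a block of at least two edges, together with its mirror image, shows that the
  coordinate vectors of both edges lie in \<open>T\<close>. Since \<open>F\<close> has the value 1 at every edge that is alone
  in its block, \<open>ln F\<close> is a combination of coordinate vectors in \<open>T\<close>, and subtracting it from the
  origin leads to 0.
\<close>
lemma zero_in_affine_hull_log_lumpable:
  fixes E :: "('y::finite \<times> 'y) set" and \<kappa> :: "'y \<Rightarrow> 'x"
  assumes "lumpable_pos \<kappa> E \<noteq> {}"
  shows "0 \<in> affine hull (log_lumpable \<kappa> E)"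
proof -
  obtain P where P: "P \<in> pos_edge_space E" "lumpable \<kappa> E P"
    using assms by (auto simp: lumpable_pos_def)
  define n where "n y x' = card {y'. (y, y') \<in> E \<and> \<kappa> y' = x'}" for y x'
  \<comment> \<open>A lumpable positive matrix has a positive sum over the block of one vertex of the fibre, hence
    over that of every vertex of the fibre; so no block of a lumped edge is empty.\<close>
  have npos: "n y x' > 0" if block: "(\<kappa> y, x') \<in> lumped_edges \<kappa> E" for y x'
  proof -
    have "\<exists>a b. (a, b) \<in> E \<and> \<kappa> a = \<kappa> y \<and> \<kappa> b = x'"
      using block unfolding lumped_edges_def by force
    then obtain a b where ab: "(a, b) \<in> E" "\<kappa> a = \<kappa> y" "\<kappa> b = x'" by blast
    have "0 < fibre_sum \<kappa> P a x'" unfolding fibre_sum_def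
      by (rule sum_pos2[where i = b]) (use ab edge_pos[OF P(1)] entry_nonneg[OF P(1)] in auto)
    also have "\<dots> = fibre_sum \<kappa> P y x'"
      using P(2) ab(2) unfolding lumpable_iff[OF P(1)] by blast
    finally have "\<exists>y' \<in> \<kappa> -` {x'}. P $ y $ y' \<noteq> 0"
      unfolding fibre_sum_def by (metis less_irrefl sum.neutral)
    then have "{y'. (y, y') \<in> E \<and> \<kappa> y' = x'} \<noteq> {}" using off_edge_zero[OF P(1)] by blast
    then show ?thesis by (simp add: n_def card_gt_0_iff)
  qed
  have npos_edge: "n y (\<kappa> y') > 0" if "(y, y') \<in> E" for y y'
    by (rule npos) (use that in \<open>force simp: lumped_edges_def\<close>)
  define F :: "real^'y^'y" where "F = (\<chi> y y'. if (y, y') \<in> E then 1 / n y (\<kappa> y') else 0)"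
  have Fp: "F \<in> pos_edge_space E"
    by (rule pos_edge_spaceI) (auto simp: F_def npos_edge)
  have "fibre_sum \<kappa> F y x' = 1" if "(\<kappa> y, x') \<in> lumped_edges \<kappa> E" for y x'
  proof -
    have "fibre_sum \<kappa> F y x' = (\<Sum>y' \<in> {y'. (y, y') \<in> E \<and> \<kappa> y' = x'}. 1 / n y x')"
      unfolding fibre_sum_def F_def by (rule sum.mono_neutral_cong_right) auto
    also have "\<dots> = 1" using npos[OF that] by (simp flip: n_def)
    finally show ?thesis .
  qed
  then have "lumpable \<kappa> E F" by (auto simp: lumpable_def)
  then have F: "F \<in> lumpable_pos \<kappa> E" using Fp by (simp add: lumpable_pos_def)
  define A where "A = affine hull (log_lumpable \<kappa> E)"
  define T where "T = (\<lambda>x. - edge_log E F + x) ` A"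
  have base: "edge_log E F \<in> A"
    unfolding A_def log_lumpable_def by (rule hull_inc) (use F in blast)
  have T: "subspace T"
    unfolding T_def by (rule affine_diffs_subspace) (use base in \<open>simp_all add: A_def\<close>)
  have T_iff: "d \<in> T \<longleftrightarrow> edge_log E F + d \<in> A" for d
  proof
    assume "d \<in> T"
    then obtain x where "x \<in> A" "d = - edge_log E F + x" unfolding T_def by blast
    then show "edge_log E F + d \<in> A" by simp
  next
    assume "edge_log E F + d \<in> A"
    then have "- edge_log E F + (edge_log E F + d) \<in> T" unfolding T_def by (rule imageI)
    then show "d \<in> T" by simp
  qed
  have shift: "ln (1/2) *\<^sub>R edge_unit a b + ln (3/2) *\<^sub>R edge_unit a c \<in> T"
    if "(a, b) \<in> E" "(a, c) \<in> E" "b \<noteq> c" "\<kappa> b = \<kappa> c" for a b c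
    unfolding T_iff A_def
    by (rule hull_inc, rule log_lumpable_shift[OF F that]) (use that in \<open>simp add: F_def\<close>)
  have unit: "edge_unit a b \<in> T" if ab: "(a, b) \<in> E" and "n a (\<kappa> b) \<noteq> 1" for a b
  proof -
    have "\<exists>c. (a, c) \<in> E \<and> b \<noteq> c \<and> \<kappa> b = \<kappa> c"
    proof (rule ccontr)
      assume *: "\<not> ?thesis"
      have "{y'. (a, y') \<in> E \<and> \<kappa> y' = \<kappa> b} = {b}"
      proof (intro set_eqI iffI)
        fix c assume "c \<in> {y'. (a, y') \<in> E \<and> \<kappa> y' = \<kappa> b}"
        then have "(a, c) \<in> E" "\<kappa> b = \<kappa> c" by simp_all
        with * have "b = c" by blast
        then show "c \<in> {b}" by simp
      qed (use ab in simp)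
      then have "n a (\<kappa> b) = 1" unfolding n_def by simp
      with that(2) show False by simp
    qed
    then obtain c where c: "(a, c) \<in> E" "b \<noteq> c" "\<kappa> b = \<kappa> c" by blast
    \<comment> \<open>The vectors \<open>(p, q)\<close> and \<open>(q, p)\<close> are independent because \<open>p + q = ln (3/4)\<close> and
      \<open>p - q = ln (1/3)\<close> do not vanish; a suitable combination of them isolates the first coordinate.\<close>
    define p q where "p = ln (1/2 :: real)" and "q = ln (3/2 :: real)"
    have "q > 0" by (simp add: q_def)
    moreover have "p + q < 0"
    proof -
      have "p + q = ln ((1/2) * (3/2))" unfolding p_def q_def by (rule ln_mult_pos[symmetric]) auto
      then show ?thesis by simp
    qed
    ultimately have pq: "p\<^sup>2 - q\<^sup>2 \<noteq> 0" by (auto simp: power2_eq_square square_diff_square_factored)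
    have u1: "p *\<^sub>R edge_unit a b + q *\<^sub>R edge_unit a c \<in> T"
      using shift[OF ab c] by (simp add: p_def q_def)
    have u2: "p *\<^sub>R edge_unit a c + q *\<^sub>R edge_unit a b \<in> T"
      using shift[of a c b] ab c by (simp add: p_def q_def)
    have "p *\<^sub>R (p *\<^sub>R edge_unit a b + q *\<^sub>R edge_unit a c)
        - q *\<^sub>R (p *\<^sub>R edge_unit a c + q *\<^sub>R edge_unit a b) \<in> T"
      by (intro subspace_diff subspace_scale T u1 u2)
    also have "p *\<^sub>R (p *\<^sub>R edge_unit a b + q *\<^sub>R edge_unit a c)
        - q *\<^sub>R (p *\<^sub>R edge_unit a c + q *\<^sub>R edge_unit a b) = (p\<^sup>2 - q\<^sup>2) *\<^sub>R edge_unit a b"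
      by (simp add: algebra_simps power2_eq_square)
    finally have "(1 / (p\<^sup>2 - q\<^sup>2)) *\<^sub>R ((p\<^sup>2 - q\<^sup>2) *\<^sub>R edge_unit a b) \<in> T"
      by (rule subspace_scale[OF T])
    then show ?thesis using pq by simp
  qed
  have "(\<Sum>(a, b)\<in>E. ln (n a (\<kappa> b)) *\<^sub>R edge_unit a b) \<in> T"
  proof (rule subspace_sum[OF T])
    fix e assume "e \<in> E"
    then show "(case e of (a, b) \<Rightarrow> ln (n a (\<kappa> b)) *\<^sub>R edge_unit a b) \<in> T"
      using unit subspace_scale[OF T] subspace_0[OF T]
      by (cases e; cases "n (fst e) (\<kappa> (snd e)) = 1") auto
  qed
  also have "(\<Sum>(a, b)\<in>E. ln (n a (\<kappa> b)) *\<^sub>R edge_unit a b) = - edge_log E F"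
  proof -
    have "(\<Sum>(a, b)\<in>E. ln (n a (\<kappa> b)) *\<^sub>R edge_unit a b) $ y $ y' = (- edge_log E F) $ y $ y'"
      for y y'
    proof -
      have "(\<Sum>(a, b)\<in>E. ln (n a (\<kappa> b)) *\<^sub>R edge_unit a b) $ y $ y'
          = (\<Sum>e\<in>E. ln (n (fst e) (\<kappa> (snd e))) * edge_unit (fst e) (snd e) $ y $ y')"
        by (simp add: case_prod_unfold)
      also have "\<dots> = (\<Sum>e\<in>E. if e = (y, y') then ln (n y (\<kappa> y')) else 0)"
        by (rule sum.cong) (auto simp: edge_unit_def)
      also have "\<dots> = (if (y, y') \<in> E then ln (n y (\<kappa> y')) else 0)" by simp
      also have "\<dots> = (- edge_log E F) $ y $ y'"
        using npos_edge[of y y'] by (simp add: edge_log_nth F_def ln_div)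
      finally show ?thesis .
    qed
    then show ?thesis by (simp add: vec_eq_iff)
  qed
  finally have "edge_log E F + - edge_log E F \<in> A" by (simp only: T_iff)
  then show ?thesis by (simp add: A_def)
qed

section \<open>The e-hull modulo the null space\<close>
lemma affine_hull_indexed:
  assumes "x \<in> affine hull S"
  obtains k :: nat and \<alpha> p where "(\<Sum>i=1..k. \<alpha> i) = 1" "\<And>i. i \<in> {1..k} \<Longrightarrow> p i \<in> S"
    "x = (\<Sum>i=1..k. \<alpha> i *\<^sub>R p i)"
proof -
  obtain T u where T: "finite T" "T \<subseteq> S" "sum u T = 1" "(\<Sum>v\<in>T. u v *\<^sub>R v) = x"
    using assms unfolding affine_hull_explicit by blast
  obtain h where h: "bij_betw h {1..card T} T" using ex_bij_betw_nat_finite_1[OF T(1)] by blast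
  show thesis
  proof (rule that[where k = "card T" and \<alpha> = "u \<circ> h" and p = h])
    show "(\<Sum>i=1..card T. (u \<circ> h) i) = 1" using sum.reindex_bij_betw[OF h, of u] T(3) by simp
    show "h i \<in> S" if "i \<in> {1..card T}" for i using bij_betwE[OF h] that T(2) by blast
    show "x = (\<Sum>i=1..card T. (u \<circ> h) i *\<^sub>R h i)"
      using sum.reindex_bij_betw[OF h, of "\<lambda>v. u v *\<^sub>R v"] T(4) by simp
  qed
qed

lemma coset_map_eq_iff:
  assumes "subspace N"
  shows "coset_map N A = coset_map N B \<longleftrightarrow> A - B \<in> N"
proof
  assume "coset_map N A = coset_map N B"
  then have "A + 0 \<in> B +o N" using subspace_0[OF assms] unfolding coset_map_def by (metis set_plus_intro2)
  then show "A - B \<in> N" by (auto simp: elt_set_plus_def)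
next
  assume AB: "A - B \<in> N"
  have "C \<in> A +o N \<longleftrightarrow> C \<in> B +o N" for C
  proof -
    have "C \<in> A +o N \<longleftrightarrow> C - A \<in> N" "C \<in> B +o N \<longleftrightarrow> C - B \<in> N"
      by (auto simp: elt_set_plus_def) (metis add_diff_cancel_left' diff_add_cancel add.commute)+
    moreover have "C - B = (C - A) + (A - B)" "C - A = (C - B) - (A - B)" by simp_all
    ultimately show ?thesis using subspace_add[OF assms] subspace_diff[OF assms] AB by metis
  qed
  then show "coset_map N A = coset_map N B" unfolding coset_map_def by blast
qed

theorem proposition4p3:
  fixes E :: "('y::finite \<times> 'y) set" and \<kappa> :: "'y \<Rightarrow> 'x"
  assumes "E \<noteq> {}"
    and "strongly_connected E"
    and "surj \<kappa>"
    and "1 < card (UNIV :: 'x set)"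
    and "card (UNIV :: 'x set) < card (UNIV :: 'y set)"
    and "lumpable_stochastic \<kappa> E \<noteq> {}"
  shows "bij_betw (coset_map (null_space E)) (log_e_hull \<kappa> E)
    (quotient_space (span (log_lumpable \<kappa> E) + null_space E) (null_space E))"
proof -
  let ?N = "null_space E" and ?G = "log_lumpable \<kappa> E" and ?W = "lumpable_stochastic \<kappa> E"
  note E = assms(1,2)
  note N = subspace_null_space[of E]
  have W_G: "edge_log E P \<in> ?G" if "P \<in> ?W" for P
    using that by (auto simp: log_lumpable_def lumpable_stochastic_def lumpable_pos_def stochastic_def)
  have "lumpable_pos \<kappa> E \<noteq> {}"
    using assms(6) by (auto simp: lumpable_stochastic_def lumpable_pos_def stochastic_def)
  then have span_G: "span ?G = affine hull ?G"
    by (metis affine_hull_span_0 zero_in_affine_hull_log_lumpable)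
  have hullE: "\<exists>Q P. A = edge_log E P \<and> P \<in> stochastic E \<and> edge_log E Q \<in> span ?G
      \<and> A - edge_log E Q \<in> ?N" if A: "A \<in> log_e_hull \<kappa> E" for A
  proof -
    obtain Q k \<alpha> P where Q: "A = edge_log E (stoch_rescale Q)" "Q \<in> pos_edge_space E"
      and P: "\<forall>i\<in>{1..k::nat}. P i \<in> ?W" "edge_log E Q = (\<Sum>i=1..k. \<alpha> i *\<^sub>R edge_log E (P i))"
      using A unfolding log_e_hull_def e_hull_def by blast
    have "edge_log E Q \<in> span ?G" unfolding P(2)
      by (intro span_sum span_scale span_base W_G) (use P(1) in blast)
    then show ?thesis using Q stoch_rescale_stochastic[OF Q(2) E] by blast
  qed
  have inj: "inj_on (coset_map ?N) (log_e_hull \<kappa> E)"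
  proof (rule inj_onI)
    fix A B assume A: "A \<in> log_e_hull \<kappa> E" and B: "B \<in> log_e_hull \<kappa> E"
      and eq: "coset_map ?N A = coset_map ?N B"
    obtain P Q where "A = edge_log E P" "P \<in> stochastic E" "B = edge_log E Q" "Q \<in> stochastic E"
      using hullE[OF A] hullE[OF B] by blast
    then show "A = B" using eq stochastic_inj_mod_null_space[of Q E P] assms(2)
      by (simp add: coset_map_eq_iff[OF N])
  qed
  have into: "coset_map ?N A \<in> quotient_space (span ?G + ?N) ?N" if A: "A \<in> log_e_hull \<kappa> E" for A
  proof -
    obtain Q where Q: "edge_log E Q \<in> span ?G" "A - edge_log E Q \<in> ?N" using hullE[OF A] by blast
    have "edge_log E Q + (A - edge_log E Q) \<in> span ?G + ?N" using Q by (rule set_plus_intro)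
    then show ?thesis unfolding quotient_space_def by simp
  qed
  have onto: "\<exists>B \<in> log_e_hull \<kappa> E. coset_map ?N B = coset_map ?N A" if A: "A \<in> span ?G + ?N" for A
  proof -
    obtain g d where gd: "A = g + d" "g \<in> affine hull ?G" "d \<in> ?N"
      using A unfolding span_G by (rule set_plus_elim)
    obtain k :: nat and \<alpha> p where \<alpha>: "(\<Sum>i=1..k. \<alpha> i) = 1"
      and p: "\<And>i. i \<in> {1..k} \<Longrightarrow> p i \<in> ?G" and g: "g = (\<Sum>i=1..k. \<alpha> i *\<^sub>R p i)"
      using affine_hull_indexed[OF gd(2)] by metis
    \<comment> \<open>Exchange each lumpable matrix for a stochastic one; the coefficients, and so their sum 1,
      remain.\<close>
    have "\<exists>P \<in> ?W. edge_log E P - p i \<in> ?N" if i: "i \<in> {1..k}" for i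
    proof -
      obtain F where F: "F \<in> lumpable_pos \<kappa> E" "p i = edge_log E F"
        using p[OF i] unfolding log_lumpable_def by blast
      show ?thesis using lumpable_pos_mod_null_space[OF F(1) E] F(2) by metis
    qed
    then obtain P where P: "\<And>i. i \<in> {1..k} \<Longrightarrow> P i \<in> ?W"
      "\<And>i. i \<in> {1..k} \<Longrightarrow> edge_log E (P i) - p i \<in> ?N" by metis
    define h where "h = (\<Sum>i=1..k. \<alpha> i *\<^sub>R edge_log E (P i))"
    define Q :: "real^'y^'y" where "Q = (\<chi> y y'. if (y, y') \<in> E then exp (h $ y $ y') else 0)"
    have "h \<in> edge_space E" unfolding h_def
      by (intro subspace_sum subspace_scale subspace_edge_space edge_log_in_edge_space)
    then have logQ: "edge_log E Q = h"
      by (auto simp: vec_eq_iff edge_log_nth Q_def edge_space_def)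
    have Q: "Q \<in> pos_edge_space E" by (rule pos_edge_spaceI) (auto simp: Q_def)
    have B: "edge_log E (stoch_rescale Q) \<in> log_e_hull \<kappa> E"
      unfolding log_e_hull_def e_hull_def using Q P(1) \<alpha> logQ[unfolded h_def] by blast
    have "h - g = (\<Sum>i=1..k. \<alpha> i *\<^sub>R (edge_log E (P i) - p i))"
      by (simp add: h_def g scaleR_diff_right sum_subtractf)
    then have "h - g \<in> ?N" using P(2) by (auto intro!: subspace_sum subspace_scale N)
    then have "(edge_log E (stoch_rescale Q) - h) + (h - g) - d \<in> ?N"
      using stoch_rescale_stochastic(2)[OF Q E] gd(3) \<open>h - g \<in> ?N\<close> unfolding logQ
      by (metis subspace_add[OF N] subspace_diff[OF N])
    also have "(edge_log E (stoch_rescale Q) - h) + (h - g) - d = edge_log E (stoch_rescale Q) - A"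
      by (simp add: gd(1))
    finally show ?thesis using B by (auto simp: coset_map_eq_iff[OF N])
  qed
  have "coset_map ?N ` log_e_hull \<kappa> E = quotient_space (span ?G + ?N) ?N"
  proof
    show "coset_map ?N ` log_e_hull \<kappa> E \<subseteq> quotient_space (span ?G + ?N) ?N"
      by (rule image_subsetI) (rule into)
    show "quotient_space (span ?G + ?N) ?N \<subseteq> coset_map ?N ` log_e_hull \<kappa> E"
      unfolding quotient_space_def
    proof (rule image_subsetI)
      fix A assume "A \<in> span ?G + ?N"
      then obtain B where "B \<in> log_e_hull \<kappa> E" "coset_map ?N B = coset_map ?N A"
        using onto by blast
      then show "coset_map ?N A \<in> coset_map ?N ` log_e_hull \<kappa> E" by (metis imageI)
    qed
  qed
  then show ?thesis using inj by (simp add: bij_betw_def)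
qed

end
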